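(* Let $m$ and $n$ be nonnegative integers. Then $$T_{n+m,m}(q) = \sum_{k = 0}^{\lfloor n/2\rfloor} q^{2k(k+m)} \begin{bmatrix} n \\ 2k\end{bmatrix}_q \frac{(-q^{k+m+1};q)_{n-k}}{(-q;q)_k}\, T_{k,m}(q).$$
   Context: $q$ is an indeterminate; identities are in the field of rational functions in $q$. $(a;q)_0=1$ and $(a;q)_n=\prod_{k=0}^{n-1}(1-aq^k)$ for $n\ge 1$. $[i]_q=\frac{1-q^i}{1-q}$, $[k]_q!=\prod_{i=1}^k [i]_q$, and $\begin{bmatrix} n\\k\end{bmatrix}_q=\frac{[n]_q!}{[k]_q![n-k]_q!}$ for $0\le k\le n$. The $q$-super Catalan numbers are, for nonnegative integers $n,m$, $T_{n,m}(q)=\frac{[2m]_q!\,[2n]_q!}{[m]_q!\,[n]_q!\,[m+n]_q!}$. *)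

theory Defs
  imports
    "HOL-Computational_Algebra.Polynomial"
    "HOL-Computational_Algebra.Fraction_Field"
begin

definition q_pochhammer :: "'a::field \<Rightarrow> 'a \<Rightarrow> nat \<Rightarrow> 'a" where
  "q_pochhammer a q n = (\<Prod>k<n. 1 - a * q ^ k)"

(* Meaningful for q \<noteq> 1 only; at q = 1 division by zero makes it 0. *)
definition q_int :: "'a::field \<Rightarrow> nat \<Rightarrow> 'a" where
  "q_int q i = (1 - q ^ i) / (1 - q)"

definition q_fact :: "'a::field \<Rightarrow> nat \<Rightarrow> 'a" where
  "q_fact q k = (\<Prod>i=1..k. q_int q i)"

(* The guard is needed because n - k truncates on nat. *)
definition q_binomial :: "'a::field \<Rightarrow> nat \<Rightarrow> nat \<Rightarrow> 'a" where
  "q_binomial q n k = (if k \<le> n then q_fact q n / (q_fact q k * q_fact q (n - k)) else 0)"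

definition q_super_catalan :: "'a::field \<Rightarrow> nat \<Rightarrow> nat \<Rightarrow> 'a" where
  "q_super_catalan q n m =
     q_fact q (2 * m) * q_fact q (2 * n) / (q_fact q m * q_fact q n * q_fact q (m + n))"

end

theory Submission
  imports Defs
begin

text \<open>
  Writing \<open>P\<close>, \<open>E\<close>, \<open>O\<close> for \<open>(q;q)\<close>, \<open>(q^2;q^2)\<close>, \<open>(q;q^2)\<close> and using \<open>P_{2N} = E_N O_N\<close> and
  \<open>E_N = P_N (-q;q)_N\<close>, the claim reduces, after cancelling the factors independent of \<open>k\<close>, to
  \<open>\<Sum>k. q^(2k(k+m)) / (P_{n-2k} E_k E_{m+k}) = O_{n+m} / (P_n P_{n+2m})\<close>.
  The right-hand side satisfies a first-order recurrence in \<open>n\<close>; the summand on the left satisfies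
  the same recurrence up to a telescoping difference (a q-Wilf--Zeilberger certificate).
\<close>

section \<open>q-Pochhammer symbols and q-factorials\<close>

lemma q_pochhammer_0 [simp]: "q_pochhammer a q 0 = 1"
  by (simp add: q_pochhammer_def)

lemma q_pochhammer_Suc: "q_pochhammer a q (Suc n) = q_pochhammer a q n * (1 - a * q ^ n)"
  by (simp add: q_pochhammer_def)

lemma q_pochhammer_add:
  "q_pochhammer a q (m + n) = q_pochhammer a q m * q_pochhammer (a * q ^ m) q n"
  by (induction n) (simp_all add: q_pochhammer_Suc power_add mult_ac)

lemma q_pochhammer_double:
  "q_pochhammer q q (2 * n) = q_pochhammer (q\<^sup>2) (q\<^sup>2) n * q_pochhammer q (q\<^sup>2) n"
proof (induction n)
  case (Suc n)
  have e: "q * q ^ (2 * n) = q * (q\<^sup>2) ^ n" "q * q ^ Suc (2 * n) = q\<^sup>2 * (q\<^sup>2) ^ n"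
    by (simp_all add: power_mult power2_eq_square)
  have "q_pochhammer q q (2 * Suc n) =
      q_pochhammer q q (2 * n) * (1 - q * q ^ (2 * n)) * (1 - q * q ^ Suc (2 * n))"
    by (simp only: mult_Suc_right add_2_eq_Suc q_pochhammer_Suc)
  then show ?case
    unfolding e Suc by (simp only: q_pochhammer_Suc mult_ac)
qed simp

lemma q_pochhammer_square:
  "q_pochhammer (q\<^sup>2) (q\<^sup>2) n = q_pochhammer q q n * q_pochhammer (- q) q n"
proof (induction n)
  case (Suc n)
  have "1 - q\<^sup>2 * (q\<^sup>2) ^ n = (1 - q * q ^ n) * (1 - (- q) * q ^ n)"
    by (simp add: algebra_simps power2_eq_square power_mult_distrib)
  then show ?case using Suc by (simp only: q_pochhammer_Suc mult_ac)
qed simp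

lemma q_fact_eq: "q_fact q n = q_pochhammer q q n / (1 - q) ^ n"
  by (induction n) (simp_all add: q_fact_def q_pochhammer_Suc q_int_def)

text \<open>What the argument uses about the indeterminate: every factor \<open>1 - q ^ i\<close>
  with \<open>0 < i\<close> may be cancelled.\<close>

locale no_root_of_unity =
  fixes q :: "'a::field"
  assumes power_neq_1: "0 < i \<Longrightarrow> q ^ i \<noteq> 1"
begin

text \<open>The second and fourth products are factors of \<open>q_pochhammer q q (2 * n)\<close>,
  and the third is a factor of the second.\<close>

lemma q_pochhammer_nonzero:
  "q_pochhammer q q n \<noteq> 0" "q_pochhammer (q\<^sup>2) (q\<^sup>2) n \<noteq> 0" "q_pochhammer (- q) q n \<noteq> 0"
  "q_pochhammer q (q\<^sup>2) n \<noteq> 0"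
proof -
  show P: "q_pochhammer q q n \<noteq> 0" for n
    using power_neq_1[of "Suc _"] by (auto simp: q_pochhammer_def)
  show "q_pochhammer (q\<^sup>2) (q\<^sup>2) n \<noteq> 0"
    using P[of "2 * n"] by (simp add: q_pochhammer_double)
  then show "q_pochhammer (- q) q n \<noteq> 0"
    by (simp add: q_pochhammer_square)
  show "q_pochhammer q (q\<^sup>2) n \<noteq> 0"
    using P[of "2 * n"] by (simp add: q_pochhammer_double)
qed

section \<open>The reduced sum and its telescoping recurrence\<close>

text \<open>The guard encodes the convention that 1/(q;q)_j is 0 for negative j, which truncated
  subtraction would miss.\<close>

definition summand :: "nat \<Rightarrow> nat \<Rightarrow> nat \<Rightarrow> 'a" where
  "summand m n k = (if 2 * k \<le> n then q ^ (2 * k * (k + m)) /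
     (q_pochhammer q q (n - 2 * k) * q_pochhammer (q\<^sup>2) (q\<^sup>2) k * q_pochhammer (q\<^sup>2) (q\<^sup>2) (m + k))
     else 0)"

text \<open>
  The truncation in \<open>Suc n - 2 * k\<close> is harmless: \<open>summand m (Suc n) k\<close> vanishes whenever \<open>Suc n < 2 * k\<close>.
\<close>

definition certificate :: "nat \<Rightarrow> nat \<Rightarrow> nat \<Rightarrow> 'a" where
  "certificate m n k =
     - (q ^ (Suc n - 2 * k) * (1 - q ^ (2 * k)) * (1 - q ^ (2 * m + 2 * k)) * summand m (Suc n) k)"

lemma summand_shift_left:
  assumes "2 * k \<le> n"
  shows "summand m n k = (1 - q ^ (Suc n - 2 * k)) * summand m (Suc n) k"
proof -
  obtain j where n: "n = 2 * k + j" using assms le_Suc_ex by blast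
  show ?thesis
    using power_neq_1[of "Suc j"] by (simp add: summand_def n q_pochhammer_Suc Suc_diff_le)
qed

text \<open>The ratio of consecutive terms in k, cleared of denominators: the exponent grows by 4k +
  2m + 2, P loses its last two factors, and both E symbols gain one.\<close>

lemma summand_shift_right:
  assumes "2 * k + 2 \<le> n"
  shows "(1 - q ^ (2 * k + 2)) * (1 - q ^ (2 * m + 2 * k + 2)) * summand m n (Suc k) =
    q ^ (4 * k + 2 * m + 2) * (1 - q ^ (n - 2 * k)) * (1 - q ^ (n - 2 * k - 1)) * summand m n k"
proof -
  obtain j where n: "n = 2 * k + 2 + j" using assms le_Suc_ex by blast
  have *: "n - 2 * k = Suc (Suc j)" "n - 2 * Suc k = j" using n by simp_all
  have "2 * Suc k * (Suc k + m) = 2 * k * (k + m) + (4 * k + 2 * m + 2)"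
    by (simp add: algebra_simps)
  then have e: "q ^ (2 * Suc k * (Suc k + m)) = q ^ (2 * k * (k + m)) * q ^ (4 * k + 2 * m + 2)"
    by (simp only: power_add)
  have P: "q_pochhammer q q (n - 2 * k) =
      q_pochhammer q q j * (1 - q ^ (n - 2 * k - 1)) * (1 - q ^ (n - 2 * k))"
    by (simp add: * q_pochhammer_Suc)
  have E: "q_pochhammer (q\<^sup>2) (q\<^sup>2) (Suc i) = q_pochhammer (q\<^sup>2) (q\<^sup>2) i * (1 - q ^ (2 * i + 2))" for i
    by (simp add: q_pochhammer_Suc mult.commute flip: power_mult power_add)
  have nz: "1 - q ^ i \<noteq> 0" if "0 < i" for i
    using power_neq_1[OF that] by simp
  \<comment> \<open>Here \<open>a\<close>, \<open>b\<close> are the factors gained by the E symbols,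
    \<open>c\<close>, \<open>d\<close> those lost by P, and \<open>p\<close>, \<open>e\<close>,
    \<open>f\<close> the parts common to both terms.\<close>
  have cancel: "a * b * (x * y / (p * (e * a) * (f * b))) = y * d * c * (x / (p * c * d * e * f))"
    if "a \<noteq> 0" "b \<noteq> 0" "c \<noteq> 0" "d \<noteq> 0" for a b c d e f p x y :: 'a
    using that by simp
  have "2 * k \<le> n" "2 * Suc k \<le> n" using n by simp_all
  then have "(1 - q ^ (2 * k + 2)) * (1 - q ^ (2 * (m + k) + 2)) * summand m n (Suc k) =
    q ^ (4 * k + 2 * m + 2) * (1 - q ^ (n - 2 * k)) * (1 - q ^ (n - 2 * k - 1)) * summand m n k"
    unfolding summand_def add_Suc_right E P e *(2)
    by (simp only: if_True) (rule cancel, (rule nz, simp add: n)+)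
  then show ?thesis by (simp add: algebra_simps)
qed

lemma summand_telescope:
  "(1 - q ^ Suc n) * (1 - q ^ (Suc n + 2 * m)) * summand m (Suc n) k
     - (1 - q ^ (2 * n + 2 * m + 1)) * summand m n k
   = certificate m n (Suc k) - certificate m n k"
proof -
  \<comment> \<open>The split follows which of the terms at (n, k), (n+1, k), (n+1, k+1) are cut off
    by the guard: all, all but the second, only the third, or none.\<close>
  consider "Suc n < 2 * k" | "Suc n = 2 * k" | "n = 2 * k" | j where "n = 2 * k + 1 + j"
    by (metis Suc_eq_plus1 add_Suc less_iff_Suc_add linorder_neqE_nat not_less_eq add.commute add_Suc_right)
  then show ?thesis
  proof cases
    case 1
    then show ?thesis by (simp add: summand_def certificate_def)
  next
    case 2
    then have "summand m n k = 0" "summand m (Suc n) (Suc k) = 0"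
      by (simp_all add: summand_def)
    then show ?thesis
      by (simp add: certificate_def 2 add.commute del: power_Suc)
  next
    case 3
    define u y z where "u = summand m (Suc n) k" and "y = q ^ n" and "z = q ^ (2 * m)"
    have "summand m n k = (1 - q) * u"
      using summand_shift_left[of k n m] by (simp add: 3 u_def)
    moreover have "certificate m n (Suc k) = 0"
      by (simp add: certificate_def summand_def 3)
    moreover have "certificate m n k = - (q * (1 - y) * (1 - z * y) * u)"
      by (simp add: certificate_def 3 y_def z_def u_def power_add)
    moreover have "q ^ Suc n = y * q" "q ^ (Suc n + 2 * m) = y * z * q"
      "q ^ (2 * n + 2 * m + 1) = y * y * z * q"
      by (simp_all add: y_def z_def mult_2 flip: power_add power_Suc2)
    ultimately show ?thesis
      unfolding u_def[symmetric] by (simp only:) (simp add: algebra_simps)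
  next
    case (4 j)
    define u y z w where "u = summand m (Suc n) k"
      and "y = q ^ (2 * k)" and "z = q ^ (2 * m)" and "w = q ^ j"
    have L: "summand m n k = (1 - q * q * w) * u"
      using summand_shift_left[of k n m] by (simp add: 4 u_def w_def)
    have e: "q ^ (4 * k + 2 * m + 2) = y * y * z * q * q"
      by (simp add: y_def z_def flip: power_add power_Suc2)
    have R: "(1 - y * q * q) * (1 - z * y * q * q) * summand m (Suc n) (Suc k) =
        y * y * z * q * q * (1 - q * q * w) * (1 - q * w) * u"
      using summand_shift_right[of k "Suc n" m] unfolding e
      by (simp add: 4 u_def w_def y_def z_def power_add mult_ac)
    \<comment> \<open>The factors of the certificate at \<open>Suc k\<close> are those on the left
      of \<open>R\<close>, so every term becomes a polynomial multiple of \<open>u\<close> and only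
      a polynomial identity in \<open>q\<close>, \<open>y\<close>, \<open>z\<close>,
      \<open>w\<close> remains.\<close>
    have "certificate m n (Suc k) = - (w * (y * y * z * q * q * (1 - q * q * w) * (1 - q * w) * u))"
      unfolding R[symmetric]
      by (simp add: certificate_def 4 w_def y_def z_def power_add mult_ac)
    moreover have "certificate m n k = - (w * q * q * (1 - y) * (1 - z * y) * u)"
      by (simp add: certificate_def 4 w_def y_def z_def u_def power_add mult_ac)
    moreover have "q ^ Suc n = y * w * q * q" "q ^ (Suc n + 2 * m) = y * w * z * q * q"
      "q ^ (2 * n + 2 * m + 1) = y * y * w * w * z * q * q * q"
      by (simp_all add: 4 w_def y_def z_def mult_2 ac_simps flip: power_add power_Suc power_Suc2)
    ultimately show ?thesis
      unfolding L u_def[symmetric] by (simp only:) (simp add: algebra_simps)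
  qed
qed

text \<open>Terms past \<open>n div 2\<close> vanish, so the sums for n and n+1 can share one
  range.\<close>

lemma sum_summand_lessThan:
  assumes "n < N"
  shows "(\<Sum>k<N. summand m n k) = (\<Sum>k=0..n div 2. summand m n k)"
  using assms by (intro sum.mono_neutral_right) (auto simp: summand_def)

lemma sum_summand:
  "(\<Sum>k=0..n div 2. summand m n k) =
     q_pochhammer q (q\<^sup>2) (n + m) / (q_pochhammer q q n * q_pochhammer q q (n + 2 * m))"
proof (induction n)
  case 0
  show ?case
    using q_pochhammer_nonzero
    by (simp add: summand_def q_pochhammer_double)
next
  case (Suc n)
  let ?S = "\<lambda>n. \<Sum>k=0..n div 2. summand m n k"
  have "(1 - q ^ Suc n) * (1 - q ^ (Suc n + 2 * m)) * (\<Sum>k<n+2. summand m (Suc n) k)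
      - (1 - q ^ (2 * n + 2 * m + 1)) * (\<Sum>k<n+2. summand m n k)
      = (\<Sum>k<n+2. certificate m n (Suc k) - certificate m n k)"
    by (simp only: summand_telescope[symmetric] sum_subtractf sum_distrib_left)
  also have "\<dots> = certificate m n (n + 2) - certificate m n 0"
    by (rule sum_lessThan_telescope)
  \<comment> \<open>At \<open>n + 2\<close> the summand is cut off; at 0 the factor
    \<open>1 - q ^ (2 * k)\<close> vanishes.\<close>
  also have "\<dots> = 0"
    by (simp add: certificate_def summand_def)
  finally have "(1 - q ^ Suc n) * (1 - q ^ (Suc n + 2 * m)) * ?S (Suc n)
      = (1 - q ^ (2 * n + 2 * m + 1)) * ?S n"
    by (simp add: sum_summand_lessThan del: power_Suc sum.lessThan_Suc)
  moreover have "1 - q ^ Suc n \<noteq> 0" "1 - q ^ (Suc n + 2 * m) \<noteq> 0"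
    using power_neq_1[of "Suc n"] power_neq_1[of "Suc n + 2 * m"] by simp_all
  ultimately have "?S (Suc n) = (1 - q ^ (2 * n + 2 * m + 1)) * ?S n
      / ((1 - q ^ Suc n) * (1 - q ^ (Suc n + 2 * m)))"
    by (simp add: nonzero_eq_divide_eq mult_ac del: power_Suc)
  \<comment> \<open>This is the factor that O gains in passing from n + m to n + m + 1.\<close>
  moreover have "1 - q * (q\<^sup>2) ^ (n + m) = 1 - q ^ (2 * n + 2 * m + 1)"
    by (simp flip: power_mult add: algebra_simps)
  ultimately show ?case
    unfolding Suc add_Suc q_pochhammer_Suc
    by (simp only: power_Suc times_divide_eq_right divide_divide_eq_left mult_ac)
qed

section \<open>Return to q-binomials and q-super Catalan numbers\<close>

lemma q_super_catalan_eq: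
  "q_super_catalan q n m = q_pochhammer q q (2 * m) * q_pochhammer q q (2 * n) /
     (q_pochhammer q q m * q_pochhammer q q n * q_pochhammer q q (m + n))"
proof -
  have "(1 - q) ^ (2 * m) * (1 - q) ^ (2 * n) = (1 - q) ^ m * (1 - q) ^ n * (1 - q) ^ (m + n)"
    by (simp add: mult_2 add_ac flip: power_add)
  moreover have "1 - q \<noteq> 0" using power_neq_1[of 1] by simp
  ultimately show ?thesis
    by (simp add: q_super_catalan_def q_fact_eq)
qed

lemma q_binomial_eq:
  assumes "k \<le> n"
  shows "q_binomial q n k =
    q_pochhammer q q n / (q_pochhammer q q k * q_pochhammer q q (n - k))"
proof -
  have "(1 - q) ^ n = (1 - q) ^ k * (1 - q) ^ (n - k)"
    using assms by (simp flip: power_add)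
  moreover have "1 - q \<noteq> 0" using power_neq_1[of 1] by simp
  ultimately show ?thesis
    using assms by (simp add: q_binomial_def q_fact_eq)
qed

text \<open>P_{2k} cancels between the binomial and T_{k,m}. Then P_k (-q;q)_k = E_k, and extending
  the shifted symbol by (-q;q)_{m+k} gives (-q;q)_{n+m} above and E_{m+k} below.\<close>

lemma q_super_catalan_term:
  assumes "2 * k \<le> n"
  shows "q ^ (2 * k * (k + m)) * q_binomial q n (2 * k) *
       (q_pochhammer (- (q ^ (k + m + 1))) q (n - k) / q_pochhammer (- q) q k) *
       q_super_catalan q k m =
    q_pochhammer q q n * q_pochhammer (- q) q (n + m) * q_pochhammer q q (2 * m)
      / q_pochhammer q q m * summand m n k"
proof -
  have "n + m = (m + k) + (n - k)" using assms by simp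
  then have "q_pochhammer (- q) q (n + m) =
      q_pochhammer (- q) q (m + k) * q_pochhammer (- (q ^ (k + m + 1))) q (n - k)"
    by (simp only: q_pochhammer_add[of _ _ "m + k"]) (simp add: add.commute)
  then show ?thesis
    using assms q_pochhammer_nonzero
    by (simp add: q_super_catalan_eq q_binomial_eq summand_def q_pochhammer_square ac_simps)
qed

theorem q_super_catalan_sum:
  "q_super_catalan q (n + m) m =
    (\<Sum>k=0..n div 2. q ^ (2 * k * (k + m)) * q_binomial q n (2 * k) *
       (q_pochhammer (- (q ^ (k + m + 1))) q (n - k) / q_pochhammer (- q) q k) *
       q_super_catalan q k m)" (is "_ = ?rhs")
proof -
  let ?c = "q_pochhammer q q n * q_pochhammer (- q) q (n + m) * q_pochhammer q q (2 * m)
      / q_pochhammer q q m"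
  have "?rhs = (\<Sum>k=0..n div 2. ?c * summand m n k)"
    by (intro sum.cong refl q_super_catalan_term) auto
  also have "\<dots> = ?c * (q_pochhammer q (q\<^sup>2) (n + m) /
      (q_pochhammer q q n * q_pochhammer q q (n + 2 * m)))"
    by (simp only: sum_distrib_left[symmetric] sum_summand)
  also have "\<dots> = q_super_catalan q (n + m) m"
  proof -
    \<comment> \<open>The numerator of T_{n+m,m} contains P_{2(n+m)}; this factorization cancels its
      P_{n+m} and leaves the (-q;q) and O symbols of the closed form.\<close>
    have double: "q_pochhammer q q (2 * (n + m)) =
        q_pochhammer q q (n + m) * q_pochhammer (- q) q (n + m) * q_pochhammer q (q\<^sup>2) (n + m)"
      by (simp only: q_pochhammer_double q_pochhammer_square)
    have "m + (n + m) = n + 2 * m" by simp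
    then show ?thesis
      using q_pochhammer_nonzero by (simp only: q_super_catalan_eq double) simp
  qed
  finally show ?thesis by simp
qed

end

section \<open>Specialization to the indeterminate\<close>

lemma Fract_X_power: "Fract [:0, 1:] 1 ^ i = Fract ([:0, 1:] ^ i) (1 :: 'a::field poly)"
  by (induction i) (simp_all add: One_fract_def)

theorem proposition1:
  fixes q :: "'a::field_char_0 poly fract" and m n :: nat
  assumes "q = Fract [:0, 1:] 1"
  shows "q_super_catalan q (n + m) m =
    (\<Sum>k=0..n div 2. q ^ (2 * k * (k + m)) * q_binomial q n (2 * k) *
       (q_pochhammer (- (q ^ (k + m + 1))) q (n - k) / q_pochhammer (- q) q k) *
       q_super_catalan q k m)"
proof -
  interpret no_root_of_unity q
  proof
    fix i :: nat
    assume "0 < i"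
    \<comment> \<open>A power of the indeterminate with positive exponent is told apart from 1 by
      its degree.\<close>
    have "degree ([:0, 1:] ^ i :: 'a poly) = i"
      by (simp add: degree_power_eq)
    then have "[:0, 1:] ^ i \<noteq> (1 :: 'a poly)"
      using \<open>0 < i\<close> by (metis degree_1 less_numeral_extra(3))
    then show "q ^ i \<noteq> 1"
      by (simp add: assms Fract_X_power One_fract_def eq_fract)
  qed
  show ?thesis by (rule q_super_catalan_sum)
qed

end
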